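(* Let $X$ be a non-empty compact Hausdorff space, $\sigma:X\to X$ a homeomorphism, and $\Sigma=(X,\sigma)$. The following are equivalent: (1) $I\cap C(X)\neq\{0\}$ for every non-zero closed ideal $I$ of $\ell^1(\Sigma)$; (2) $I\cap C(X)\neq\{0\}$ for every non-zero self-adjoint closed ideal $I$ of $\ell^1(\Sigma)$; (3) $C(X)$ is a maximal abelian subalgebra of $\ell^1(\Sigma)$; (4) $\Sigma$ is topologically free.
   Context: Let $\alpha$ be the automorphism of $C(X)$ (continuous complex-valued functions with supremum norm $\|\cdot\|_\infty$) given by $\alpha(f)=f\circ\sigma^{-1}$. The unital Banach $^*$-algebra $\ell^1(\Sigma)$ is the Banach space $\{a:\mathbb Z\to C(X) : \|a\|=\sum_{k\in\mathbb Z}\|a(k)\|_\infty<\infty\}$ with pointwise linear operations, product $(ab)(n)=\sum_{k\in\mathbb Z}a(k)\cdot\alpha^k(b(n-k))$ and involution $a^*(n)=\overline{\alpha^n(a(-n))}$. $C(X)$ is identified with the closed subalgebra of elements supported at $0\in\mathbb Z$. Ideals are two-sided. An ideal $I$ is self-adjoint if $a^*\in I$ for all $a\in I$. $\Sigma$ is topologically free if the set of aperiodic points $\{x\in X:\sigma^n(x)\neq x\text{ for all }n\geq 1\}$ is dense in $X$. *)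

theory Defs
  imports "HOL-Analysis.Analysis"
begin

text \<open>
  For a compact space \<open>'a\<close>, the type \<open>'a \<Rightarrow>\<^sub>C complex\<close> of bounded continuous functions with the
  supremum norm is $C(X)$. The library makes it a normed space; here it also gets the pointwise
  product, and completeness is extended from metric domains to arbitrary topological ones.
\<close>

unbundle bcontfun.lifting

instantiation bcontfun :: (topological_space, real_normed_algebra) real_normed_algebra
begin

lift_definition times_bcontfun :: "('a \<Rightarrow>\<^sub>C 'b) \<Rightarrow> ('a \<Rightarrow>\<^sub>C 'b) \<Rightarrow> 'a \<Rightarrow>\<^sub>C 'b"
  is "\<lambda>f g x. f x * g x"
proof -
  fix f g :: "'a \<Rightarrow> 'b"
  assume "f \<in> bcontfun" "g \<in> bcontfun"
  then obtain A B where "continuous_on UNIV f" "continuous_on UNIV g"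
    and AB: "\<And>x. norm (f x) \<le> A" "\<And>x. norm (g x) \<le> B"
    by (auto simp: bcontfun_def bounded_iff)
  moreover have "norm (f x * g x) \<le> A * B" for x
    by (rule order_trans[OF norm_mult_ineq])
      (intro mult_mono AB norm_ge_zero order_trans[OF norm_ge_zero AB(1)])
  ultimately show "(\<lambda>x. f x * g x) \<in> bcontfun"
    by (intro bcontfun_normI continuous_on_mult)
qed

instance
proof
  fix f g h :: "'a \<Rightarrow>\<^sub>C 'b" and r :: real
  show "norm (f * g) \<le> norm f * norm g"
  proof (rule norm_bound)
    fix x
    have "norm (apply_bcontfun f x * apply_bcontfun g x)
        \<le> norm (apply_bcontfun f x) * norm (apply_bcontfun g x)"
      by (rule norm_mult_ineq)
    also have "\<dots> \<le> norm f * norm g"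
      by (intro mult_mono norm_bounded) auto
    finally show "norm (apply_bcontfun (f * g) x) \<le> norm f * norm g"
      by (simp add: times_bcontfun.rep_eq)
  qed
qed (auto intro!: bcontfun_eqI simp: times_bcontfun.rep_eq algebra_simps)

end

instance bcontfun :: (topological_space, complete_space) complete_space
proof
  fix f :: "nat \<Rightarrow> ('a, 'b) bcontfun"
  assume "Cauchy f"
  then obtain g where "uniform_limit UNIV f g sequentially"
    using uniformly_convergent_eq_cauchy[of "\<lambda>_. True" f]
    unfolding Cauchy_def uniform_limit_sequentially_iff
    by (metis dist_fun_lt_imp_dist_val_lt)
  from uniform_limit_bcontfunE[OF this sequentially_bot]
  obtain l' where "g = apply_bcontfun l'" "(f \<longlonglongrightarrow> l')" by metis
  then show "convergent f"
    by (intro convergentI)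
qed

instance bcontfun :: (topological_space, banach) banach ..

lift_definition cnj_bcontfun :: "('a::topological_space \<Rightarrow>\<^sub>C complex) \<Rightarrow> ('a \<Rightarrow>\<^sub>C complex)"
  is "\<lambda>f x. cnj (f x)"
  by (auto simp: bcontfun_def bounded_iff intro!: continuous_intros)

text \<open>Integer powers of a bijection.\<close>

definition zpow :: "('b \<Rightarrow> 'b) \<Rightarrow> int \<Rightarrow> 'b \<Rightarrow> 'b"
  where "zpow f k = (if k \<ge> 0 then f ^^ nat k else inv f ^^ nat (- k))"

text \<open>Intended for a homeomorphism \<open>\<sigma>\<close>: otherwise \<open>f \<circ> inv \<sigma>\<close> need not be continuous.\<close>

definition alpha :: "('a::topological_space \<Rightarrow> 'a) \<Rightarrow> ('a \<Rightarrow>\<^sub>C complex) \<Rightarrow> ('a \<Rightarrow>\<^sub>C complex)"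
  where "alpha \<sigma> f = Bcontfun (apply_bcontfun f \<circ> inv \<sigma>)"

text \<open>
  The Banach space underlying $\ell^1(\Sigma)$ does not depend on \<open>\<sigma>\<close>; only the product and the
  involution do, and so they are functions with parameter \<open>\<sigma>\<close> rather than class operations.
\<close>

typedef (overloaded) 'a ell1 =
    "{a :: int \<Rightarrow> ('a::topological_space \<Rightarrow>\<^sub>C complex). (\<lambda>k. norm (a k)) summable_on UNIV}"
  morphisms apply_ell1 Abs_ell1
  by (rule exI[of _ "\<lambda>_. 0"]) simp

setup_lifting type_definition_ell1

lemma summable_apply_ell1: "(\<lambda>k. norm (apply_ell1 a k)) summable_on UNIV"
  using apply_ell1[of a] by simp

lemma ell1_eqI: "(\<And>k. apply_ell1 a k = apply_ell1 b k) \<Longrightarrow> a = b"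
  by transfer auto

lemma summable_norm_add:
  fixes a b :: "'i \<Rightarrow> 'b::real_normed_vector"
  assumes "(\<lambda>k. norm (a k)) summable_on A" "(\<lambda>k. norm (b k)) summable_on A"
  shows "(\<lambda>k. norm (a k + b k)) summable_on A"
proof -
  have "(\<lambda>k. norm (a k) + norm (b k)) summable_on A"
    using assms by (rule summable_on_add)
  then show ?thesis
    by (rule summable_on_comparison_test) (auto intro: norm_triangle_ineq)
qed

instantiation ell1 :: (topological_space) real_vector
begin

lift_definition zero_ell1 :: "'a ell1" is "\<lambda>_. 0" by simp

lift_definition plus_ell1 :: "'a ell1 \<Rightarrow> 'a ell1 \<Rightarrow> 'a ell1" is "\<lambda>a b k. a k + b k"
  by (rule summable_norm_add)

lift_definition uminus_ell1 :: "'a ell1 \<Rightarrow> 'a ell1" is "\<lambda>a k. - a k" by simp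

lift_definition minus_ell1 :: "'a ell1 \<Rightarrow> 'a ell1 \<Rightarrow> 'a ell1" is "\<lambda>a b k. a k - b k"
  using summable_norm_add[where b = "\<lambda>k. - b k" for b] by fastforce

lift_definition scaleR_ell1 :: "real \<Rightarrow> 'a ell1 \<Rightarrow> 'a ell1" is "\<lambda>r a k. r *\<^sub>R a k"
  by (auto intro: summable_on_cmult_right)

instance
  by standard (transfer; simp add: algebra_simps)+

end

instantiation ell1 :: (topological_space) real_normed_vector
begin

lift_definition norm_ell1 :: "'a ell1 \<Rightarrow> real" is "\<lambda>a. \<Sum>\<^sub>\<infinity>k. norm (a k)" .

definition dist_ell1 :: "'a ell1 \<Rightarrow> 'a ell1 \<Rightarrow> real"
  where "dist_ell1 a b = norm (a - b)"

definition sgn_ell1 :: "'a ell1 \<Rightarrow> 'a ell1"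
  where "sgn_ell1 a = a /\<^sub>R norm a"

definition uniformity_ell1 :: "('a ell1 \<times> 'a ell1) filter"
  where "uniformity_ell1 = (INF e\<in>{0 <..}. principal {(x, y). dist x y < e})"

definition open_ell1 :: "'a ell1 set \<Rightarrow> bool"
  where "open_ell1 S = (\<forall>x\<in>S. \<forall>\<^sub>F (x', y) in uniformity. x' = x \<longrightarrow> y \<in> S)"

instance
proof
  fix a b :: "'a ell1" and r :: real
  show "norm a = 0 \<longleftrightarrow> a = 0"
  proof
    assume "norm a = 0"
    then have "norm (apply_ell1 a k) = 0" for k
      by (intro nonneg_infsum_le_0D[of "\<lambda>k. norm (apply_ell1 a k)" UNIV k])
        (auto simp: norm_ell1.rep_eq summable_apply_ell1)
    then show "a = 0"
      by (intro ell1_eqI) (simp add: zero_ell1.rep_eq)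
  qed (simp add: norm_ell1.rep_eq zero_ell1.rep_eq)
  have "(\<Sum>\<^sub>\<infinity>k. norm (apply_ell1 a k + apply_ell1 b k))
      \<le> (\<Sum>\<^sub>\<infinity>k. norm (apply_ell1 a k) + norm (apply_ell1 b k))"
    by (intro infsum_mono summable_norm_add summable_on_add summable_apply_ell1)
      (auto intro: norm_triangle_ineq)
  also have "\<dots> = (\<Sum>\<^sub>\<infinity>k. norm (apply_ell1 a k)) + (\<Sum>\<^sub>\<infinity>k. norm (apply_ell1 b k))"
    by (intro infsum_add summable_apply_ell1)
  finally show "norm (a + b) \<le> norm a + norm b"
    by (simp add: norm_ell1.rep_eq plus_ell1.rep_eq)
  show "norm (r *\<^sub>R a) = \<bar>r\<bar> * norm a"
    by (simp add: norm_ell1.rep_eq scaleR_ell1.rep_eq infsum_cmult_right' )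
qed (rule dist_ell1_def sgn_ell1_def open_ell1_def uniformity_ell1_def)+

end

lift_definition scaleC_ell1 :: "complex \<Rightarrow> 'a::topological_space ell1 \<Rightarrow> 'a ell1"
  is "\<lambda>c a k. const_bcontfun c * a k"
proof -
  fix c :: complex and a :: "int \<Rightarrow> ('a \<Rightarrow>\<^sub>C complex)"
  assume "(\<lambda>k. norm (a k)) summable_on UNIV"
  then have "(\<lambda>k. norm (const_bcontfun c :: 'a \<Rightarrow>\<^sub>C complex) * norm (a k)) summable_on UNIV"
    by (rule summable_on_cmult_right)
  then show "(\<lambda>k. norm (const_bcontfun c * a k)) summable_on UNIV"
    by (rule summable_on_comparison_test) (auto intro: norm_mult_ineq)
qed

definition mult_ell1 :: "('a::topological_space \<Rightarrow> 'a) \<Rightarrow> 'a ell1 \<Rightarrow> 'a ell1 \<Rightarrow> 'a ell1"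
  where "mult_ell1 \<sigma> a b =
    Abs_ell1 (\<lambda>n. \<Sum>\<^sub>\<infinity>k. apply_ell1 a k * zpow (alpha \<sigma>) k (apply_ell1 b (n - k)))"

definition star_ell1 :: "('a::topological_space \<Rightarrow> 'a) \<Rightarrow> 'a ell1 \<Rightarrow> 'a ell1"
  where "star_ell1 \<sigma> a =
    Abs_ell1 (\<lambda>n. cnj_bcontfun (zpow (alpha \<sigma>) n (apply_ell1 a (- n))))"

text \<open>
  For a homeomorphism the families above are absolutely summable, so \<open>Abs_ell1\<close> is applied to
  members of its representing set (\<open>apply_mult_ell1\<close>, \<open>apply_star_ell1\<close>).
\<close>

lemma apply_alpha:
  assumes "continuous_on UNIV (inv \<sigma>)"
  shows "apply_bcontfun (alpha \<sigma> f) x = apply_bcontfun f (inv \<sigma> x)"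
proof -
  have "continuous_on UNIV (apply_bcontfun f \<circ> inv \<sigma>)"
    using assms by (intro continuous_on_compose) auto
  then have "apply_bcontfun f \<circ> inv \<sigma> \<in> bcontfun"
    by (intro bcontfun_normI[where b = "norm f"]) (auto simp: norm_bounded)
  then show ?thesis
    by (simp add: alpha_def Bcontfun_inverse)
qed

lemma inv_alpha:
  assumes "homeomorphism UNIV UNIV \<sigma> (inv \<sigma>)"
  shows "inv (alpha \<sigma>) = alpha (inv \<sigma>)"
proof -
  have c: "continuous_on UNIV \<sigma>" "continuous_on UNIV (inv \<sigma>)"
    and i: "\<And>x. inv \<sigma> (\<sigma> x) = x" "\<And>x. \<sigma> (inv \<sigma> x) = x"
    using assms by (auto simp: homeomorphism_def)
  have ii: "inv (inv \<sigma>) = \<sigma>"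
    by (rule inv_equality) (auto simp: i)
  show ?thesis
    by (rule inv_equality) (auto intro!: bcontfun_eqI simp: apply_alpha c ii i)
qed

lemma norm_zpow_alpha:
  assumes "homeomorphism UNIV UNIV \<sigma> (inv \<sigma>)"
  shows "norm (zpow (alpha \<sigma>) k f) = norm f"
proof -
  have c: "continuous_on UNIV \<sigma>" "continuous_on UNIV (inv \<sigma>)"
    and i: "\<And>x. inv \<sigma> (\<sigma> x) = x" "\<And>x. \<sigma> (inv \<sigma> x) = x"
    using assms by (auto simp: homeomorphism_def)
  have ii: "inv (inv \<sigma>) = \<sigma>"
    by (rule inv_equality) (auto simp: i)
  have a: "norm (alpha \<sigma> f) = norm f" for f
  proof (rule antisym)
    show "norm (alpha \<sigma> f) \<le> norm f"
      by (rule norm_bound) (simp add: apply_alpha c norm_bounded)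
    show "norm f \<le> norm (alpha \<sigma> f)"
      by (rule norm_bound) (metis apply_alpha c(2) i(1) norm_bounded)
  qed
  have b: "norm (alpha (inv \<sigma>) f) = norm f" for f
  proof (rule antisym)
    show "norm (alpha (inv \<sigma>) f) \<le> norm f"
      by (rule norm_bound) (simp add: apply_alpha c ii norm_bounded)
    show "norm f \<le> norm (alpha (inv \<sigma>) f)"
      by (rule norm_bound) (metis apply_alpha c(1) ii i(2) norm_bounded)
  qed
  have "norm ((alpha \<sigma> ^^ m) f) = norm f" "norm ((alpha (inv \<sigma>) ^^ m) f) = norm f" for m
    by (induction m) (auto simp: a b)
  then show ?thesis
    by (simp add: zpow_def inv_alpha[OF assms])
qed

lemma apply_mult_ell1:
  assumes "homeomorphism UNIV UNIV \<sigma> (inv \<sigma>)"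
  shows "apply_ell1 (mult_ell1 \<sigma> a b) n =
    (\<Sum>\<^sub>\<infinity>k. apply_ell1 a k * zpow (alpha \<sigma>) k (apply_ell1 b (n - k)))"
    and "(\<lambda>k. norm (apply_ell1 a k * zpow (alpha \<sigma>) k (apply_ell1 b (n - k)))) summable_on UNIV"
proof -
  define t where "t n k = apply_ell1 a k * zpow (alpha \<sigma>) k (apply_ell1 b (n - k))" for n k
  have "(\<lambda>(i, j). norm (apply_ell1 a i) * norm (apply_ell1 b j)) summable_on UNIV \<times> UNIV"
    by (rule summable_on_SigmaI[where g = "\<lambda>i. norm (apply_ell1 a i) * norm b"])
      (auto simp: norm_ell1.rep_eq
        intro!: has_sum_cmult_right has_sum_infsum summable_apply_ell1 summable_on_cmult_left)
  moreover have "bij (\<lambda>(n, k). (k, n - k :: int))"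
    by (rule bij_betw_byWitness[where f' = "\<lambda>(k, j). (k + j, k)"]) auto
  ultimately have "(\<lambda>(n, k). norm (apply_ell1 a k) * norm (apply_ell1 b (n - k)))
      summable_on UNIV \<times> UNIV"
    by (subst (asm) summable_on_reindex_bij_betw[symmetric]) (auto simp: case_prod_unfold)
  then have "(\<lambda>(n, k). norm (t n k)) summable_on UNIV \<times> UNIV"
    by (rule summable_on_comparison_test)
      (auto simp: t_def norm_zpow_alpha[OF assms]
        intro: order_trans[OF norm_mult_ineq])
  then have *: "(\<lambda>p. norm (case p of (n, k) \<Rightarrow> t n k)) summable_on Sigma UNIV (\<lambda>_. UNIV)"
    by (simp add: case_prod_unfold)
  then have s: "\<And>n. (\<lambda>k. norm (t n k)) summable_on UNIV"
    and s2: "(\<lambda>n. norm (\<Sum>\<^sub>\<infinity>k. norm (t n k))) summable_on UNIV"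
    using iffD1[OF Infinite_Sum.abs_summable_on_Sigma_iff *] by auto
  from s2 have "(\<lambda>n. norm (\<Sum>\<^sub>\<infinity>k. t n k)) summable_on UNIV"
    by (rule summable_on_comparison_test)
      (auto intro!: order_trans[OF norm_infsum_bound[OF s]])
  then show "apply_ell1 (mult_ell1 \<sigma> a b) n =
      (\<Sum>\<^sub>\<infinity>k. apply_ell1 a k * zpow (alpha \<sigma>) k (apply_ell1 b (n - k)))"
    by (simp add: mult_ell1_def t_def Abs_ell1_inverse)
  show "(\<lambda>k. norm (apply_ell1 a k * zpow (alpha \<sigma>) k (apply_ell1 b (n - k)))) summable_on UNIV"
    using s by (simp add: t_def)
qed

lemma apply_star_ell1:
  assumes "homeomorphism UNIV UNIV \<sigma> (inv \<sigma>)"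
  shows "apply_ell1 (star_ell1 \<sigma> a) n = cnj_bcontfun (zpow (alpha \<sigma>) n (apply_ell1 a (- n)))"
proof -
  have "norm (cnj_bcontfun f) \<le> norm f" for f :: "'a \<Rightarrow>\<^sub>C complex"
    by (rule norm_bound) (simp add: cnj_bcontfun.rep_eq norm_bounded)
  then have le: "norm (cnj_bcontfun (zpow (alpha \<sigma>) n (apply_ell1 a (- n))))
      \<le> norm (apply_ell1 a (- n))" for n
    by (metis norm_zpow_alpha[OF assms])
  have "bij (uminus :: int \<Rightarrow> int)"
    by (rule bij_betw_byWitness[where f' = uminus]) auto
  then have "(\<lambda>n. norm (apply_ell1 a (- n))) summable_on UNIV"
    using summable_apply_ell1[of a] by (subst summable_on_reindex_bij_betw)
  then have "(\<lambda>n. norm (cnj_bcontfun (zpow (alpha \<sigma>) n (apply_ell1 a (- n))))) summable_on UNIV"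
    by (rule summable_on_comparison_test) (auto intro: le)
  then show ?thesis
    by (simp add: star_ell1_def Abs_ell1_inverse)
qed

text \<open>$C(X)$ as the set of elements of $\ell^1(\Sigma)$ supported at \<open>0\<close>.\<close>

definition CX :: "'a::topological_space ell1 set"
  where "CX = {a. \<forall>k. k \<noteq> 0 \<longrightarrow> apply_ell1 a k = 0}"

definition csubspace_ell1 :: "'a::topological_space ell1 set \<Rightarrow> bool"
  where "csubspace_ell1 V \<longleftrightarrow>
    0 \<in> V \<and> (\<forall>a\<in>V. \<forall>b\<in>V. a + b \<in> V) \<and> (\<forall>c. \<forall>a\<in>V. scaleC_ell1 c a \<in> V)"

definition ideal_ell1 :: "('a::topological_space \<Rightarrow> 'a) \<Rightarrow> 'a ell1 set \<Rightarrow> bool"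
  where "ideal_ell1 \<sigma> I \<longleftrightarrow>
    csubspace_ell1 I \<and> (\<forall>a\<in>I. \<forall>b. mult_ell1 \<sigma> a b \<in> I \<and> mult_ell1 \<sigma> b a \<in> I)"

definition self_adjoint :: "('a::topological_space \<Rightarrow> 'a) \<Rightarrow> 'a ell1 set \<Rightarrow> bool"
  where "self_adjoint \<sigma> I \<longleftrightarrow> (\<forall>a\<in>I. star_ell1 \<sigma> a \<in> I)"

definition abelian_subalgebra :: "('a::topological_space \<Rightarrow> 'a) \<Rightarrow> 'a ell1 set \<Rightarrow> bool"
  where "abelian_subalgebra \<sigma> B \<longleftrightarrow>
    csubspace_ell1 B \<and> (\<forall>a\<in>B. \<forall>b\<in>B. mult_ell1 \<sigma> a b \<in> B)
    \<and> (\<forall>a\<in>B. \<forall>b\<in>B. mult_ell1 \<sigma> a b = mult_ell1 \<sigma> b a)"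

definition maximal_abelian_subalgebra :: "('a::topological_space \<Rightarrow> 'a) \<Rightarrow> 'a ell1 set \<Rightarrow> bool"
  where "maximal_abelian_subalgebra \<sigma> B \<longleftrightarrow>
    abelian_subalgebra \<sigma> B \<and> (\<forall>D. abelian_subalgebra \<sigma> D \<and> B \<subseteq> D \<longrightarrow> D = B)"

definition topologically_free :: "('a::topological_space \<Rightarrow> 'a) \<Rightarrow> bool"
  where "topologically_free \<sigma> \<longleftrightarrow> closure {x. \<forall>n\<ge>1. (\<sigma> ^^ n) x \<noteq> x} = UNIV"

end

theory Submission
  imports Defs
begin

text \<open>
  Write \<open>a(k)(x)\<close> for the values of the coefficients of \<open>a\<close>; then
  \<open>(ab)(n)(x) = (\<Sum>k. a(k)(x) \<cdot> b(n - k)(\<sigma>\<^sup>-\<^sup>k x))\<close>, and every question becomes one about complex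
  numbers. Topological freeness is shown to force every nonzero closed ideal to meet \<open>C(X)\<close>, to
  follow if only the self-adjoint ones do, and to be equivalent to maximality of \<open>C(X)\<close>.

  Let \<open>\<sigma>\<close> be topologically free. Suppose that a closed ideal \<open>I\<close> meets \<open>C(X)\<close> only in \<open>0\<close>, and that some \<open>a \<in> I\<close> has
  \<open>a(0)(x) = 1\<close> at an aperiodic point \<open>x\<close>. Up to a small tail, \<open>a\<close> is supported on finitely
  many \<open>k\<close>, and \<open>x\<close> has a neighbourhood \<open>U\<close> disjoint from its translates by the nonzero ones
  among these. For a bump function \<open>f\<close> supported in \<open>U\<close>, the compression \<open>f a f\<close> has no coefficients at
  these nonzero \<open>k\<close>, so it is nearly the function \<open>f\<^sup>2 a(0)\<close>, and that is nearly \<open>1\<close> close to \<open>x\<close>. If \<open>h\<close> is a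
  second bump with \<open>h f = h\<close>, this says \<open>h - h p = h f a f \<in> I\<close> for some \<open>p\<close> with \<open>\<parallel>p\<parallel> < 1\<close>. Modulo
  \<open>I\<close> therefore \<open>h\<close> equals \<open>h p\<close>, hence \<open>h p p\<close>, and so on; these tend to \<open>0\<close>, so that
  \<open>h \<in> I\<close> because \<open>I\<close> is closed, although \<open>h \<noteq> 0\<close>. Hence \<open>a(0)\<close> vanishes on the dense set of
  aperiodic points (\<open>coef_0_eq_0_at_aperiodic\<close>), and translating by powers of the
  canonical unitary gives \<open>a = 0\<close>. This replaces the usual appeal to the minimality of the
  supremum norm among algebra norms on \<open>C(X)\<close>.

  Now let topological freeness fail. As the aperiodic points are not dense, Baire's theorem gives
  \<open>n \<noteq> 0\<close> and a nonempty open set \<open>U\<close> of points fixed by \<open>\<sigma>\<^sup>n\<close> (\<open>exists_open_fixed\<close>). Over the fixed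
  points of \<open>\<sigma>\<^sup>n\<close>, the \<open>n\<close>-th power of the canonical unitary is central and may be identified
  with \<open>1\<close>. The elements supported on these points that this identification kills are
  those for which the coefficients over every residue class modulo \<open>n\<close> sum to zero. They form a closed
  self-adjoint ideal (\<open>periodic_ideal\<close>). It contains \<open>h - h \<delta>\<^sup>n\<close> for every \<open>h\<close>
  supported in \<open>U\<close>, but no nonzero function, since a function is a single coefficient.

  As for maximality, commuting with all of \<open>C(X)\<close> forces \<open>a(k)(x) = 0\<close> unless \<open>\<sigma>\<^sup>k x = x\<close>. At aperiodic
  points this leaves only \<open>k = 0\<close>, so \<open>C(X)\<close> is maximal if these points are dense. In general, the elements satisfying this
  condition form an abelian algebra containing \<open>C(X)\<close> (\<open>abelian_isotropy_algebra\<close>), which also contains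
  \<open>h \<delta>\<^sup>n\<close> for \<open>h\<close> supported in \<open>U\<close> as above; so it is larger than \<open>C(X)\<close> if topological
  freeness fails.
\<close>

section \<open>Integer powers of a bijection\<close>

lemma zpow_0 [simp]: "zpow f 0 = id"
  by (simp add: zpow_def fun_eq_iff)

lemma zpow_of_nat: "zpow f (int n) = f ^^ n"
  by (simp add: zpow_def)

lemma zpow_succ:
  assumes "bij f"
  shows "zpow f (k + 1) x = f (zpow f k x)"
proof (cases "k \<ge> 0")
  case True
  then have "nat (k + 1) = Suc (nat k)" by simp
  with True show ?thesis by (simp add: zpow_def)
next
  case False
  then have k: "nat (- k) = Suc (nat (- (k + 1)))" by simp
  have "f (inv f y) = y" for y
    using assms by (simp add: bij_is_surj surj_f_inv_f)
  then show ?thesis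
    using False k by (cases "k = -1") (simp_all add: zpow_def)
qed

lemma zpow_add:
  assumes "bij f"
  shows "zpow f (k + l) x = zpow f k (zpow f l x)"
proof (induction k rule: int_induct[where k = 0])
  case (step1 i)
  then show ?case
    using zpow_succ[OF assms, of "i + l" x] zpow_succ[OF assms, of i "zpow f l x"]
    by (simp add: algebra_simps)
next
  case (step2 i)
  have "f (zpow f (i - 1 + l) x) = f (zpow f (i - 1) (zpow f l x))"
    using step2 zpow_succ[OF assms, of "i - 1 + l" x] zpow_succ[OF assms, of "i - 1" "zpow f l x"]
    by (simp add: algebra_simps)
  then show ?case
    using assms by (simp add: bij_is_inj inj_eq)
qed simp

lemma zpow_minus_cancel:
  assumes "bij f"
  shows "zpow f (- k) (zpow f k x) = x" "zpow f k (zpow f (- k) x) = x"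
  using zpow_add[OF assms, of "- k" k x] zpow_add[OF assms, of k "- k" x] by simp_all

lemma zpow_fixed_minus:
  assumes "bij f" "zpow f k x = x"
  shows "zpow f (- k) x = x"
  using zpow_minus_cancel(1)[OF assms(1), of k x] assms(2) by simp

lemma zpow_fixed_mult:
  assumes "bij f" "zpow f k x = x"
  shows "zpow f (j * k) x = x"
proof (induction j rule: int_induct[where k = 0])
  case (step1 i)
  then show ?case
    using zpow_add[OF assms(1), of "i * k" k x] assms(2) by (simp add: algebra_simps)
next
  case (step2 i)
  then show ?case
    using zpow_add[OF assms(1), of "i * k" "- k" x] zpow_fixed_minus[OF assms]
    by (simp add: algebra_simps)
qed simp

lemma zpow_fixed_shift:
  assumes "bij f" "zpow f k x = x"
  shows "zpow f k (zpow f l x) = zpow f l x"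
  using zpow_add[OF assms(1), of k l x] zpow_add[OF assms(1), of l k x] assms(2)
  by (simp add: add.commute)

section \<open>Infinite sums\<close>

lemma infsum_single:
  fixes f :: "'b \<Rightarrow> 'c::{comm_monoid_add, t2_space}"
  assumes "\<And>j. j \<noteq> i \<Longrightarrow> f j = 0"
  shows "(\<Sum>\<^sub>\<infinity>j. f j) = f i"
proof -
  have "(f has_sum f i) UNIV"
    by (rule has_sum_finite_neutralI[where B = "{i}"]) (use assms in auto)
  then show ?thesis
    by (rule infsumI)
qed

lemma infsum_diff:
  fixes f g :: "'b \<Rightarrow> 'c::real_normed_vector"
  assumes "f summable_on A" "g summable_on A"
  shows "(\<Sum>\<^sub>\<infinity>k\<in>A. f k - g k) = infsum f A - infsum g A"
  using infsum_add[OF assms(1), of "\<lambda>k. - g k"] assms(2)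
  by (simp add: summable_on_uminus infsum_uminus)

section \<open>Coefficients and the norm\<close>

abbreviation coef :: "'a::topological_space ell1 \<Rightarrow> int \<Rightarrow> 'a \<Rightarrow> complex"
  where "coef a k x \<equiv> apply_bcontfun (apply_ell1 a k) x"

lemma ell1_eq_iff_coef: "a = b \<longleftrightarrow> (\<forall>k x. coef a k x = coef b k x)"
  by (metis ell1_eqI bcontfun_eqI)

lemma coef_simps [simp]:
  "coef 0 k x = 0"
  "coef (a + b) k x = coef a k x + coef b k x"
  "coef (a - b) k x = coef a k x - coef b k x"
  "coef (r *\<^sub>R a) k x = r *\<^sub>R coef a k x"
  "coef (scaleC_ell1 c a) k x = c * coef a k x"
  by (simp_all add: zero_ell1.rep_eq plus_ell1.rep_eq minus_ell1.rep_eq scaleR_ell1.rep_eq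
      scaleC_ell1.rep_eq times_bcontfun.rep_eq const_bcontfun.rep_eq)

lemma norm_coef_le: "norm (coef a k x) \<le> norm (apply_ell1 a k)"
  by (rule norm_bounded)

lemma norm_apply_ell1_le: "norm (apply_ell1 a k) \<le> norm a"
proof -
  have "norm (apply_ell1 a k) = (\<Sum>\<^sub>\<infinity>j\<in>{k}. norm (apply_ell1 a j))"
    by simp
  also have "\<dots> \<le> norm a"
    unfolding norm_ell1.rep_eq
    by (rule infsum_mono_neutral) (auto simp: summable_apply_ell1)
  finally show ?thesis .
qed

lemma small_tail:
  fixes a :: "'b::topological_space ell1"
  assumes "e > 0"
  obtains F where "finite F" "(\<Sum>\<^sub>\<infinity>k\<in>- F. norm (apply_ell1 a k)) \<le> e"
proof -
  let ?g = "\<lambda>k. norm (apply_ell1 a k)"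
  obtain F where F: "finite F" "dist (sum ?g F) (infsum ?g UNIV) \<le> e"
    using infsum_finite_approximation[OF summable_apply_ell1[of a] assms] by auto
  have "infsum ?g (F \<union> - F) = infsum ?g F + infsum ?g (- F)"
    using F(1) by (intro infsum_Un_disjoint)
      (auto intro: summable_on_subset_banach[OF summable_apply_ell1[of a]])
  then have "infsum ?g (- F) \<le> e"
    using F by (simp add: dist_real_def)
  with F(1) show thesis by (rule that)
qed

lemma summable_norm_prod:
  fixes a b :: "'b::topological_space ell1"
  shows "(\<lambda>(i, j). norm (apply_ell1 a i) * norm (apply_ell1 b j)) summable_on UNIV \<times> UNIV"
  by (rule summable_on_SigmaI[where g = "\<lambda>i. norm (apply_ell1 a i) * norm b"])
    (auto simp: norm_ell1.rep_eq
      intro!: has_sum_cmult_right has_sum_infsum summable_apply_ell1 summable_on_cmult_left)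

lemma bounded_linear_coef: "bounded_linear (\<lambda>a. coef a k x)"
  by (rule bounded_linear_intro[where K = 1])
    (auto intro: order_trans[OF norm_coef_le norm_apply_ell1_le])

lemma coef_summable_on: "(\<lambda>k. norm (coef a k x)) summable_on UNIV"
  by (rule summable_on_comparison_test[OF summable_apply_ell1[of a]]) (auto intro: norm_coef_le)

lemma bounded_linear_apply_bcontfun:
  "bounded_linear (\<lambda>f :: 'a::topological_space \<Rightarrow>\<^sub>C complex. apply_bcontfun f x)"
  by (rule bounded_linear_intro[where K = 1]) (auto intro: norm_bounded)

text \<open>The element \<open>f \<delta>\<^sup>n\<close>, where \<open>\<delta>\<close> is the canonical unitary implementing \<open>alpha \<sigma>\<close>.\<close>

definition monom_ell1 :: "('a::topological_space \<Rightarrow>\<^sub>C complex) \<Rightarrow> int \<Rightarrow> 'a ell1"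
  where "monom_ell1 f n = Abs_ell1 (\<lambda>k. if k = n then f else 0)"

lemma apply_monom_ell1: "apply_ell1 (monom_ell1 f n) = (\<lambda>k. if k = n then f else 0)"
proof -
  have "(\<lambda>k. norm (if k = n then f else 0)) summable_on {n}"
    by simp
  then have "(\<lambda>k. norm (if k = n then f else 0)) summable_on UNIV"
    by (rule summable_on_cong_neutral[THEN iffD1, rotated -1]) auto
  then show ?thesis
    by (simp add: monom_ell1_def Abs_ell1_inverse)
qed

lemma coef_monom: "coef (monom_ell1 f n) k x = (if k = n then apply_bcontfun f x else 0)"
  by (simp add: apply_monom_ell1)

lemma monom_0_in_CX: "monom_ell1 f 0 \<in> CX"
  by (simp add: CX_def apply_monom_ell1)

lemma CX_eq_range: "CX = range (\<lambda>f. monom_ell1 f 0)"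
proof (intro set_eqI iffI)
  fix a :: "'a ell1" assume "a \<in> CX"
  then have "a = monom_ell1 (apply_ell1 a 0) 0"
    by (auto simp: CX_def apply_monom_ell1 intro!: ell1_eqI)
  then show "a \<in> range (\<lambda>f. monom_ell1 f 0)"
    by (rule range_eqI)
qed (auto simp: monom_0_in_CX)

section \<open>Product and involution in coordinates\<close>

locale compact_system =
  fixes \<sigma> :: "'a::t2_space \<Rightarrow> 'a"
  assumes compact_UNIV: "compact (UNIV :: 'a set)"
    and homeo: "homeomorphism UNIV UNIV \<sigma> (inv \<sigma>)"
begin

lemma Hausdorff_space_X: "Hausdorff_space (euclidean :: 'a topology)"
  by (metis (no_types, lifting) Hausdorff_space_def disjnt_def hausdorff open_openin)

lemma compact_space_X: "compact_space (euclidean :: 'a topology)"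
  using compact_UNIV by (simp add: compact_space_def)

lemma bij_sigma: "bij \<sigma>"
  using homeo by (auto simp: homeomorphism_def intro!: bij_betw_byWitness[where f' = "inv \<sigma>"])

lemma apply_zpow_alpha:
  "apply_bcontfun (zpow (alpha \<sigma>) k f) x = apply_bcontfun f (zpow \<sigma> (- k) x)"
proof -
  have c: "continuous_on UNIV \<sigma>" "continuous_on UNIV (inv \<sigma>)"
    using homeo by (auto simp: homeomorphism_def)
  have ii: "inv (inv \<sigma>) = \<sigma>"
    by (rule inv_inv_eq[OF bij_sigma])
  have 1: "apply_bcontfun ((alpha \<sigma> ^^ m) f) x = apply_bcontfun f ((inv \<sigma> ^^ m) x)" for m x
  proof (induction m arbitrary: x)
    case (Suc m)
    show ?case
      using Suc[of "inv \<sigma> x"] funpow_swap1[of "inv \<sigma>" m x] by (simp add: apply_alpha[OF c(2)])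
  qed simp
  have 2: "apply_bcontfun ((alpha (inv \<sigma>) ^^ m) f) x = apply_bcontfun f ((\<sigma> ^^ m) x)" for m x
  proof (induction m arbitrary: x)
    case (Suc m)
    show ?case
      using Suc[of "\<sigma> x"] funpow_swap1[of \<sigma> m x] by (simp add: apply_alpha ii c(1))
  qed simp
  show ?thesis
  proof (cases k "0 :: int" rule: linorder_cases)
    case less
    then show ?thesis
      unfolding zpow_def inv_alpha[OF homeo] by (simp add: 2)
  next
    case equal
    then show ?thesis by simp
  next
    case greater
    then show ?thesis
      unfolding zpow_def by (simp add: 1)
  qed
qed

lemma coef_mult:
  "coef (mult_ell1 \<sigma> a b) n x = (\<Sum>\<^sub>\<infinity>k. coef a k x * coef b (n - k) (zpow \<sigma> (- k) x))"
proof -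
  have "(\<lambda>k. apply_ell1 a k * zpow (alpha \<sigma>) k (apply_ell1 b (n - k))) summable_on UNIV"
    by (rule abs_summable_summable[OF apply_mult_ell1(2)[OF homeo]])
  from infsumI[OF has_sum_bounded_linear[OF bounded_linear_apply_bcontfun[of x] has_sum_infsum[OF this]]]
  show ?thesis
    by (simp add: apply_mult_ell1(1)[OF homeo] times_bcontfun.rep_eq apply_zpow_alpha)
qed

lemma coef_star:
  "coef (star_ell1 \<sigma> a) n x = cnj (coef a (- n) (zpow \<sigma> (- n) x))"
  by (simp add: apply_star_ell1[OF homeo] cnj_bcontfun.rep_eq apply_zpow_alpha)

lemma coef_mult_monom_right:
  "coef (mult_ell1 \<sigma> a (monom_ell1 f m)) n x
    = coef a (n - m) x * apply_bcontfun f (zpow \<sigma> (m - n) x)"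
  unfolding coef_mult
  by (subst infsum_single[where i = "n - m"]) (auto simp: coef_monom)

lemma coef_mult_monom_left:
  "coef (mult_ell1 \<sigma> (monom_ell1 f 0) b) n x = apply_bcontfun f x * coef b n x"
  unfolding coef_mult
  by (subst infsum_single[where i = 0]) (auto simp: coef_monom)

lemma summable_coef_mult:
  "(\<lambda>k. norm (coef a k x * coef b (n - k) (zpow \<sigma> (- k) x))) summable_on UNIV"
proof (rule summable_on_comparison_test[OF apply_mult_ell1(2)[OF homeo]])
  fix k
  show "norm (coef a k x * coef b (n - k) (zpow \<sigma> (- k) x))
      \<le> norm (apply_ell1 a k * zpow (alpha \<sigma>) k (apply_ell1 b (n - k)))"
    using norm_bounded[of "apply_ell1 a k * zpow (alpha \<sigma>) k (apply_ell1 b (n - k))" x]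
    by (simp add: times_bcontfun.rep_eq apply_zpow_alpha)
qed simp

lemma mult_diff_left: "mult_ell1 \<sigma> (a - b) c = mult_ell1 \<sigma> a c - mult_ell1 \<sigma> b c"
  unfolding ell1_eq_iff_coef
proof (intro allI)
  fix n x
  let ?t = "\<lambda>a k. coef a k x * coef c (n - k) (zpow \<sigma> (- k) x)"
  have s: "?t a summable_on UNIV" for a
    by (rule abs_summable_summable[OF summable_coef_mult])
  have "(\<Sum>\<^sub>\<infinity>k. ?t a k - ?t b k) = (\<Sum>\<^sub>\<infinity>k. ?t a k) - (\<Sum>\<^sub>\<infinity>k. ?t b k)"
    by (rule infsum_diff[OF s s])
  then show "coef (mult_ell1 \<sigma> (a - b) c) n x = coef (mult_ell1 \<sigma> a c - mult_ell1 \<sigma> b c) n x"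
    by (simp add: coef_mult left_diff_distrib)
qed

text \<open>
  The powers of \<open>alpha \<sigma>\<close> are isometric, so the norm of the product is dominated by the convolution of
  two absolutely summable sequences of norms, and Tonelli sums that to the product of the norms.
\<close>

lemma norm_mult_ell1: "norm (mult_ell1 \<sigma> a b) \<le> norm a * norm b"
proof -
  let ?F = "\<lambda>k n. norm (apply_ell1 a k) * norm (apply_ell1 b (n - k))"
  have bij: "bij (\<lambda>(k, n). (k, n - k :: int))"
    by (rule bij_betw_byWitness[where f' = "\<lambda>(k, j). (k, k + j)"]) auto
  have s: "(\<lambda>(k, n). ?F k n) summable_on UNIV \<times> UNIV"
    using summable_norm_prod[of a b]
    by (subst (asm) summable_on_reindex_bij_betw[OF bij, symmetric, unfolded UNIV_Times_UNIV[symmetric]])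
      (simp add: case_prod_unfold)
  have t: "(\<lambda>(n, k). ?F k n) summable_on UNIV \<times> UNIV"
    using s by (subst summable_on_swap) (simp add: case_prod_unfold)
  have s1: "(\<lambda>n. \<Sum>\<^sub>\<infinity>k. ?F k n) summable_on UNIV"
    using summable_on_Sigma_banach[OF t] by simp
  have s2: "(\<lambda>k. ?F k n) summable_on UNIV" for n
    using summable_on_SigmaD1[OF t, of n] by simp
  have le: "norm (apply_ell1 (mult_ell1 \<sigma> a b) n) \<le> (\<Sum>\<^sub>\<infinity>k. ?F k n)" for n
  proof -
    have "norm (apply_ell1 (mult_ell1 \<sigma> a b) n)
        \<le> (\<Sum>\<^sub>\<infinity>k. norm (apply_ell1 a k * zpow (alpha \<sigma>) k (apply_ell1 b (n - k))))"
      unfolding apply_mult_ell1(1)[OF homeo]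
      by (rule norm_infsum_bound[OF apply_mult_ell1(2)[OF homeo]])
    also have "\<dots> \<le> (\<Sum>\<^sub>\<infinity>k. ?F k n)"
      by (intro infsum_mono apply_mult_ell1(2)[OF homeo] s2)
        (metis norm_mult_ineq norm_zpow_alpha[OF homeo])
    finally show ?thesis .
  qed
  have "norm (mult_ell1 \<sigma> a b) \<le> (\<Sum>\<^sub>\<infinity>n. \<Sum>\<^sub>\<infinity>k. ?F k n)"
    unfolding norm_ell1.rep_eq[of "mult_ell1 \<sigma> a b"]
    by (intro infsum_mono summable_apply_ell1 s1 le)
  also have "\<dots> = (\<Sum>\<^sub>\<infinity>k. \<Sum>\<^sub>\<infinity>n. ?F k n)"
    by (rule infsum_swap_banach[OF s, symmetric])
  also have "\<dots> = (\<Sum>\<^sub>\<infinity>k. norm (apply_ell1 a k) * norm b)"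
  proof (rule infsum_cong)
    fix k :: int
    have "bij (\<lambda>n. n - k)"
      by (rule bij_betw_byWitness[where f' = "\<lambda>n. n + k"]) auto
    then have "(\<Sum>\<^sub>\<infinity>n. norm (apply_ell1 b (n - k))) = norm b"
      unfolding norm_ell1.rep_eq by (rule infsum_reindex_bij_betw)
    then show "(\<Sum>\<^sub>\<infinity>n. ?F k n) = norm (apply_ell1 a k) * norm b"
      by (simp add: infsum_cmult_right')
  qed
  also have "\<dots> = norm a * norm b"
    by (simp add: infsum_cmult_left' norm_ell1.rep_eq[of a])
  finally show ?thesis .
qed

lemma continuous_zpow: "continuous_on UNIV (zpow \<sigma> k)"
proof -
  have pow: "continuous_on UNIV (f ^^ n)" if "continuous_on UNIV f" for f :: "'a \<Rightarrow> 'a" and n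
  proof (induction n)
    case (Suc n)
    then show ?case
      using continuous_on_compose[OF Suc continuous_on_subset[OF that]] by (simp add: o_def)
  qed simp
  show ?thesis
    using homeo by (auto simp: homeomorphism_def zpow_def intro!: pow)
qed

section \<open>Bump functions\<close>

text \<open>
  Both functions are truncations of one Urysohn function \<open>u\<close>: \<open>h\<close> lives where \<open>u \<ge> 1/2\<close>, and
  there \<open>f = 1\<close>. Thus \<open>f\<close> acts on \<open>h\<close> as a unit while still vanishing off \<open>U\<close>.
\<close>

lemma bump_pair:
  assumes "open U" "x \<in> U"
  obtains f h :: "'a \<Rightarrow>\<^sub>C complex" where
    "\<And>y. y \<notin> U \<Longrightarrow> apply_bcontfun f y = 0" "\<And>y. norm (apply_bcontfun f y) \<le> 1"
    "\<And>y. apply_bcontfun h y * apply_bcontfun f y = apply_bcontfun h y"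
    "apply_bcontfun h x = 1"
proof -
  have "normal_space (euclidean :: 'a topology)"
    using compact_space_X Hausdorff_space_X
    by (blast intro: compact_Hausdorff_or_regular_imp_normal_space)
  then obtain u :: "'a \<Rightarrow> real" where u: "continuous_map euclidean (top_of_set {0..1}) u"
    "u ` (- U) \<subseteq> {0}" "u ` {x} \<subseteq> {1}"
    using assms by (elim Urysohn_lemma[where S = "- U" and T = "{x}" and a = 0 and b = 1])
      (auto simp: closed_closedin[symmetric] disjnt_def)
  have cont: "continuous_on UNIV u"
    using u(1) by (simp add: continuous_map_in_subtopology)
  have range: "0 \<le> u y" "u y \<le> 1" for y
    using u(1) by (auto simp: continuous_map_in_subtopology image_subset_iff)
  define f where "f = Bcontfun (\<lambda>y. complex_of_real (min 1 (2 * u y)))"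
  define h where "h = Bcontfun (\<lambda>y. complex_of_real (max 0 (2 * u y - 1)))"
  have f: "apply_bcontfun f y = complex_of_real (min 1 (2 * u y))" for y
    unfolding f_def
    by (subst Bcontfun_inverse)
      (auto intro!: bcontfun_normI[where b = 1] continuous_intros cont simp: range abs_of_nonneg)
  have h: "apply_bcontfun h y = complex_of_real (max 0 (2 * u y - 1))" for y
    unfolding h_def
    by (subst Bcontfun_inverse)
      (auto intro!: bcontfun_normI[where b = 1] continuous_intros cont simp: range)
  show thesis
  proof
    show "apply_bcontfun f y = 0" if "y \<notin> U" for y
      using that u(2) by (auto simp: f image_subset_iff)
    show "norm (apply_bcontfun f y) \<le> 1" for y
      using range[of y] by (auto simp: f min_def)
    show "apply_bcontfun h y * apply_bcontfun f y = apply_bcontfun h y" for y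
      by (auto simp: f h min_def max_def)
    show "apply_bcontfun h x = 1"
      using u(3) by (simp add: h)
  qed
qed

lemma bump:
  assumes "open U" "x \<in> U"
  obtains h :: "'a \<Rightarrow>\<^sub>C complex" where
    "\<And>y. y \<notin> U \<Longrightarrow> apply_bcontfun h y = 0" "apply_bcontfun h x = 1"
  using assms by (rule bump_pair) (metis mult_zero_right)

section \<open>Aperiodic points and fixed points\<close>

lemma aperiodic_zpow:
  assumes "\<forall>n\<ge>1. (\<sigma> ^^ n) x \<noteq> x" "k \<noteq> 0"
  shows "zpow \<sigma> k x \<noteq> x"
proof
  assume fixed: "zpow \<sigma> k x = x"
  then have "zpow \<sigma> \<bar>k\<bar> x = x"
    using zpow_fixed_minus[OF bij_sigma fixed] by (simp add: abs_if)
  then have "(\<sigma> ^^ nat \<bar>k\<bar>) x = x"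
    by (simp add: zpow_def)
  moreover have "nat \<bar>k\<bar> \<ge> 1"
    using assms(2) by simp
  ultimately show False
    using assms(1) by blast
qed

lemma zero_if_zero_on_aperiodic:
  fixes f :: "'a \<Rightarrow>\<^sub>C complex"
  assumes "topologically_free \<sigma>"
    and "\<And>x. \<forall>n\<ge>1. (\<sigma> ^^ n) x \<noteq> x \<Longrightarrow> apply_bcontfun f x = 0"
  shows "f = 0"
proof -
  have "closed {x. apply_bcontfun f x = 0}"
    by (intro closed_Collect_eq continuous_intros) auto
  then have "closure {x. \<forall>n\<ge>1. (\<sigma> ^^ n) x \<noteq> x} \<subseteq> {x. apply_bcontfun f x = 0}"
    using assms(2) by (intro closure_minimal) auto
  then show ?thesis
    using assms(1) by (auto simp: topologically_free_def intro!: bcontfun_eqI)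
qed

text \<open>
  Off the closure of the aperiodic points, the space is covered by the countably many closed sets
  of points fixed by \<open>\<sigma>\<^sup>n\<close>, \<open>n \<ge> 1\<close>. A compact Hausdorff space is Baire, so one of them has
  an interior point.
\<close>

lemma exists_open_fixed:
  assumes "\<not> topologically_free \<sigma>"
  obtains n U x where "n \<noteq> 0" "open U" "x \<in> U" "\<And>y. y \<in> U \<Longrightarrow> zpow \<sigma> n y = y"
proof -
  define Fix where "Fix n = {x. (\<sigma> ^^ n) x = x}" for n
  define A where "A = {x. \<forall>n\<ge>1. (\<sigma> ^^ n) x \<noteq> x}"
  have "closed (Fix n)" for n
    unfolding Fix_def
    by (intro closed_Collect_eq continuous_intros) 
      (use continuous_zpow[of "int n"] in \<open>simp add: zpow_of_nat\<close>)
  moreover have "\<exists>n\<ge>1. interior (Fix n) \<noteq> {}"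
  proof (rule ccontr)
    assume *: "\<not> (\<exists>n\<ge>1. interior (Fix n) \<noteq> {})"
    have "euclidean interior_of \<Union> (Fix ` {1..}) = {}"
    proof (rule Baire_category_alt)
      show "completely_metrizable_space (euclidean :: 'a topology)
          \<or> locally_compact_space (euclidean :: 'a topology) \<and> regular_space (euclidean :: 'a topology)"
        using Hausdorff_space_X compact_space_X compact_Hausdorff_imp_regular_space compact_imp_locally_compact_space by blast
    qed (use * \<open>\<And>n. closed (Fix n)\<close> in auto)
    moreover have "- closure A \<subseteq> \<Union> (Fix ` {1..})"
      using closure_subset[of A] by (auto simp: A_def Fix_def)
    then have "- closure A \<subseteq> interior (\<Union> (Fix ` {1..}))"
      by (rule interior_maximal) auto
    ultimately show False
      using assms by (auto simp: topologically_free_def A_def)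
  qed
  then obtain n x where "n \<ge> 1" "x \<in> interior (Fix n)"
    by blast
  then show thesis
    using interior_subset[of "Fix n"]
    by (intro that[of "int n" "interior (Fix n)" x]) (auto simp: Fix_def zpow_of_nat)
qed

section \<open>Maximality and the commutant\<close>

lemma csubspace_CX: "csubspace_ell1 (CX :: 'a ell1 set)"
  by (auto simp: csubspace_ell1_def CX_def zero_ell1.rep_eq plus_ell1.rep_eq scaleC_ell1.rep_eq)

lemma abelian_CX: "abelian_subalgebra \<sigma> CX"
proof -
  have "mult_ell1 \<sigma> (monom_ell1 f 0) (monom_ell1 g 0) = monom_ell1 (f * g) 0"
    and "mult_ell1 \<sigma> (monom_ell1 f 0) (monom_ell1 g 0)
      = mult_ell1 \<sigma> (monom_ell1 g 0) (monom_ell1 f 0)" for f g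
    unfolding ell1_eq_iff_coef
    by (simp_all add: coef_mult_monom_left coef_monom times_bcontfun.rep_eq mult.commute)
  then show ?thesis
    using csubspace_CX unfolding abelian_subalgebra_def CX_eq_range by (auto simp del: CX_eq_range)
qed

text \<open>
  This is the commutant of \<open>CX\<close>: commutation with \<open>f\<close> reads
  \<open>a(k)(x) (f(x) - f(\<sigma>\<^sup>-\<^sup>k x)) = 0\<close>, and continuous functions separate points.
\<close>

definition isotropy_algebra :: "'a ell1 set"
  where "isotropy_algebra = {a. \<forall>k x. coef a k x \<noteq> 0 \<longrightarrow> zpow \<sigma> k x = x}"

lemma CX_subset_isotropy_algebra: "CX \<subseteq> isotropy_algebra"
  by (auto simp: CX_eq_range isotropy_algebra_def coef_monom split: if_splits)

lemma coef_mult_isotropy: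
  assumes "a \<in> isotropy_algebra"
  shows "coef (mult_ell1 \<sigma> a b) n x = (\<Sum>\<^sub>\<infinity>k. coef a k x * coef b (n - k) x)"
  unfolding coef_mult
proof (rule infsum_cong)
  fix k
  show "coef a k x * coef b (n - k) (zpow \<sigma> (- k) x) = coef a k x * coef b (n - k) x"
    using assms zpow_fixed_minus[OF bij_sigma, of k x]
    by (cases "coef a k x = 0") (auto simp: isotropy_algebra_def)
qed

text \<open>
  On elements of the commutant the twist by \<open>\<sigma>\<^sup>-\<^sup>k\<close> disappears from the product, which becomes at each
  point \<open>x\<close> the ordinary convolution over the integers.
\<close>

lemma abelian_isotropy_algebra: "abelian_subalgebra \<sigma> isotropy_algebra"
  unfolding abelian_subalgebra_def
proof (intro conjI ballI)
  show "csubspace_ell1 isotropy_algebra"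
    unfolding csubspace_ell1_def isotropy_algebra_def by (auto simp: add_eq_0_iff) force
next
  fix a b :: "'a ell1"
  assume a: "a \<in> isotropy_algebra" and b: "b \<in> isotropy_algebra"
  have "zpow \<sigma> n x = x" if nz: "coef (mult_ell1 \<sigma> a b) n x \<noteq> 0" for n x
  proof -
    obtain k where k: "coef a k x * coef b (n - k) x \<noteq> 0"
      using nz infsum_0[of UNIV "\<lambda>k. coef a k x * coef b (n - k) x"]
      unfolding coef_mult_isotropy[OF a] by blast
    then have "zpow \<sigma> k x = x" "zpow \<sigma> (n - k) x = x"
      using a b by (auto simp: isotropy_algebra_def)
    then show ?thesis
      using zpow_add[OF bij_sigma, of k "n - k" x] by simp
  qed
  then show "mult_ell1 \<sigma> a b \<in> isotropy_algebra"
    by (auto simp: isotropy_algebra_def)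
  show "mult_ell1 \<sigma> a b = mult_ell1 \<sigma> b a"
    unfolding ell1_eq_iff_coef
  proof (intro allI)
    fix n x
    have "bij (\<lambda>k::int. n - k)"
      by (rule bij_betw_byWitness[where f' = "\<lambda>k. n - k"]) auto
    from infsum_reindex_bij_betw[OF this, of "\<lambda>k. coef b k x * coef a (n - k) x"]
    show "coef (mult_ell1 \<sigma> a b) n x = coef (mult_ell1 \<sigma> b a) n x"
      by (simp add: coef_mult_isotropy[OF a] coef_mult_isotropy[OF b] mult.commute)
  qed
qed

lemma topologically_free_if_maximal:
  assumes "maximal_abelian_subalgebra \<sigma> CX"
  shows "topologically_free \<sigma>"
proof (rule ccontr)
  assume "\<not> topologically_free \<sigma>"
  then obtain n U x where n: "n \<noteq> 0" and U: "open U" "x \<in> U" "\<And>y. y \<in> U \<Longrightarrow> zpow \<sigma> n y = y"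
    using exists_open_fixed by blast
  obtain h :: "'a \<Rightarrow>\<^sub>C complex"
    where h: "\<And>y. y \<notin> U \<Longrightarrow> apply_bcontfun h y = 0" "apply_bcontfun h x = 1"
    using bump[OF U(1,2)] by blast
  have "monom_ell1 h n \<in> isotropy_algebra"
    using h(1) U(3) by (auto simp: isotropy_algebra_def coef_monom split: if_splits)
  then have "monom_ell1 h n \<in> CX"
    using assms abelian_isotropy_algebra CX_subset_isotropy_algebra
    by (auto simp: maximal_abelian_subalgebra_def)
  then have "coef (monom_ell1 h n) n x = 0"
    using n by (simp add: CX_def)
  then show False
    using h(2) by (simp add: coef_monom)
qed

lemma maximal_if_topologically_free:
  assumes "topologically_free \<sigma>"
  shows "maximal_abelian_subalgebra \<sigma> CX"
  unfolding maximal_abelian_subalgebra_def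
proof (intro conjI allI impI abelian_CX, elim conjE)
  fix D :: "'a ell1 set"
  assume D: "abelian_subalgebra \<sigma> D" "CX \<subseteq> D"
  have "apply_ell1 a k = 0" if "a \<in> D" "k \<noteq> 0" for a k
  proof (rule zero_if_zero_on_aperiodic[OF assms])
    fix x assume x: "\<forall>n\<ge>1. (\<sigma> ^^ n) x \<noteq> x"
    \<comment> \<open>Commuting with a function that separates \<open>x\<close> from \<open>\<sigma>\<^sup>-\<^sup>k x\<close> kills the coefficient at \<open>x\<close>.\<close>
    have ne: "zpow \<sigma> (- k) x \<noteq> x"
      using aperiodic_zpow[OF x, of "- k"] \<open>k \<noteq> 0\<close> by simp
    obtain h :: "'a \<Rightarrow>\<^sub>C complex" where h: "\<And>y. y \<notin> - {zpow \<sigma> (- k) x} \<Longrightarrow> apply_bcontfun h y = 0"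
      "apply_bcontfun h x = 1"
      using ne by (elim bump[of "- {zpow \<sigma> (- k) x}" x, rotated 2]) auto
    have "mult_ell1 \<sigma> (monom_ell1 h 0) a = mult_ell1 \<sigma> a (monom_ell1 h 0)"
      using D that monom_0_in_CX[of h] unfolding abelian_subalgebra_def by blast
    then have "coef (mult_ell1 \<sigma> (monom_ell1 h 0) a) k x = coef (mult_ell1 \<sigma> a (monom_ell1 h 0)) k x"
      by simp
    then show "coef a k x = 0"
      using h by (simp add: coef_mult_monom_left coef_mult_monom_right)
  qed
  then show "D = CX"
    using D(2) by (auto simp: CX_def)
qed

section \<open>The ideal attached to an open set of periodic points\<close>

abbreviation residue_sum :: "int \<Rightarrow> 'a ell1 \<Rightarrow> int \<Rightarrow> 'a \<Rightarrow> complex"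
  where "residue_sum n a m x \<equiv> (\<Sum>\<^sub>\<infinity>j. coef a (m + j * n) x)"

lemma inj_residue: "n \<noteq> 0 \<Longrightarrow> inj (\<lambda>j::int. m + j * n)"
  by (auto simp: inj_on_def)

lemma summable_residue:
  assumes "n \<noteq> 0"
  shows "(\<lambda>j. norm (coef a (m + j * n) x)) summable_on UNIV"
proof -
  have "(\<lambda>k. norm (coef a k x)) summable_on range (\<lambda>j. m + j * n)"
    by (rule summable_on_subset_banach[OF coef_summable_on]) simp
  then show ?thesis
    by (subst (asm) summable_on_reindex[OF inj_residue[OF assms]]) (simp add: o_def)
qed

lemma bounded_linear_residue_sum:
  assumes "n \<noteq> 0"
  shows "bounded_linear (\<lambda>a. residue_sum n a m x)"
proof (rule bounded_linear_intro[where K = 1])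
  have s: "(\<lambda>j. coef a (m + j * n) x) summable_on UNIV" for a
    by (rule abs_summable_summable[OF summable_residue[OF assms]])
  fix a b :: "'a ell1" and r :: real
  show "residue_sum n (a + b) m x = residue_sum n a m x + residue_sum n b m x"
    by (simp add: infsum_add[OF s s])
  show "residue_sum n (r *\<^sub>R a) m x = r *\<^sub>R residue_sum n a m x"
    by (simp add: infsum_scaleR_right)
  have "norm (residue_sum n a m x) \<le> (\<Sum>\<^sub>\<infinity>j. norm (coef a (m + j * n) x))"
    by (rule norm_infsum_bound[OF summable_residue[OF assms]])
  also have "\<dots> = (\<Sum>\<^sub>\<infinity>k\<in>range (\<lambda>j. m + j * n). norm (coef a k x))"
    by (simp add: infsum_reindex[OF inj_residue[OF assms]] o_def)
  also have "\<dots> \<le> (\<Sum>\<^sub>\<infinity>k. norm (coef a k x))"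
    by (rule infsum_mono_neutral)
      (auto intro: summable_on_subset_banach[OF coef_summable_on] coef_summable_on)
  also have "\<dots> \<le> norm a"
    unfolding norm_ell1.rep_eq
    by (intro infsum_mono coef_summable_on summable_apply_ell1 norm_coef_le)
  finally show "norm (residue_sum n a m x) \<le> norm a * 1" by simp
qed

text \<open>
  The pairs \<open>(k, m + j n - k)\<close> are distinct for distinct \<open>(j, k)\<close> because \<open>n \<noteq> 0\<close>, so the family is
  dominated by part of the absolutely summable family of products of coefficient norms. This licenses
  exchanging the two sums in the formulas that follow.
\<close>

lemma summable_residue_mult:
  assumes "n \<noteq> 0"
  shows "(\<lambda>(j, k). coef a k x * coef b (m + j * n - k) (zpow \<sigma> (- k) x))
    summable_on UNIV \<times> UNIV"
proof (rule abs_summable_summable)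
  define g where "g = (\<lambda>(j, k). (k, m + j * n - k :: int))"
  have inj: "inj g"
    using assms by (auto simp: inj_on_def g_def)
  have "(\<lambda>(i, l). norm (apply_ell1 a i) * norm (apply_ell1 b l)) summable_on range g"
    by (rule summable_on_subset_banach[OF summable_norm_prod]) simp
  then have "(\<lambda>(j, k). norm (apply_ell1 a k) * norm (apply_ell1 b (m + j * n - k)))
      summable_on UNIV \<times> UNIV"
    by (subst (asm) summable_on_reindex[OF inj]) (simp add: o_def g_def case_prod_unfold)
  then show "(\<lambda>p. norm (case p of (j, k) \<Rightarrow>
      coef a k x * coef b (m + j * n - k) (zpow \<sigma> (- k) x))) summable_on UNIV \<times> UNIV"
    by (rule summable_on_comparison_test)
      (auto simp: norm_mult intro!: mult_mono norm_coef_le)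
qed

lemma residue_sum_mult_right:
  assumes "n \<noteq> 0"
  shows "residue_sum n (mult_ell1 \<sigma> a b) m x
    = (\<Sum>\<^sub>\<infinity>k. coef a k x * residue_sum n b (m - k) (zpow \<sigma> (- k) x))"
proof -
  have "residue_sum n (mult_ell1 \<sigma> a b) m x
      = (\<Sum>\<^sub>\<infinity>k. \<Sum>\<^sub>\<infinity>j. coef a k x * coef b (m + j * n - k) (zpow \<sigma> (- k) x))"
    unfolding coef_mult by (rule infsum_swap_banach[OF summable_residue_mult[OF assms]])
  then show ?thesis
    by (simp add: infsum_cmult_right' algebra_simps)
qed

text \<open>
  Here the summation index of the product has to move along with \<open>j\<close>, so that the index of
  \<open>a\<close> runs through a residue class. This changes the point at which \<open>b\<close> is evaluated by a power of
  \<open>\<sigma>\<^sup>n\<close>, which is harmless exactly because \<open>\<sigma>\<^sup>n\<close> fixes \<open>x\<close>.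
\<close>

lemma residue_sum_mult_left:
  assumes "n \<noteq> 0" "zpow \<sigma> n x = x"
  shows "residue_sum n (mult_ell1 \<sigma> a b) m x
    = (\<Sum>\<^sub>\<infinity>k. residue_sum n a k x * coef b (m - k) (zpow \<sigma> (- k) x))"
proof -
  let ?t = "\<lambda>j k. coef a k x * coef b (m + j * n - k) (zpow \<sigma> (- k) x)"
  have shift: "?t j (k + j * n) = coef a (k + j * n) x * coef b (m - k) (zpow \<sigma> (- k) x)" for j k
    using zpow_add[OF bij_sigma, of "- k" "- j * n" x] zpow_fixed_mult[OF bij_sigma assms(2), of "- j"]
    by simp
  \<comment> \<open>Shifting \<open>k\<close> by \<open>j n\<close> is a shear of the index plane, so summability is preserved.\<close>
  have "bij (\<lambda>(j, k). (j, k + j * n))"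
    by (rule bij_betw_byWitness[where f' = "\<lambda>(j, k). (j, k - j * n)"]) auto
  then have s: "(\<lambda>(j, k). ?t j (k + j * n)) summable_on UNIV \<times> UNIV"
    using summable_residue_mult[OF assms(1), of a x b m]
    by (subst (asm) summable_on_reindex_bij_betw[symmetric]) (auto simp: case_prod_unfold)
  have "residue_sum n (mult_ell1 \<sigma> a b) m x = (\<Sum>\<^sub>\<infinity>j. \<Sum>\<^sub>\<infinity>k. ?t j (k + j * n))"
    unfolding coef_mult
  proof (rule infsum_cong)
    fix j
    have "bij (\<lambda>k. k + j * n)"
      by (rule bij_betw_byWitness[where f' = "\<lambda>k. k - j * n"]) auto
    from infsum_reindex_bij_betw[OF this, of "?t j"]
    show "(\<Sum>\<^sub>\<infinity>k. ?t j k) = (\<Sum>\<^sub>\<infinity>k. ?t j (k + j * n))" by simp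
  qed
  also have "\<dots> = (\<Sum>\<^sub>\<infinity>k. \<Sum>\<^sub>\<infinity>j. ?t j (k + j * n))"
    by (rule infsum_swap_banach[OF s])
  finally show ?thesis
    unfolding shift by (simp add: infsum_cmult_left')
qed

text \<open>
  These are the elements that are supported over the fixed points of \<open>\<sigma>\<^sup>n\<close> and annihilated by setting
  \<open>\<delta>\<^sup>n = 1\<close> there. Both conditions ask bounded linear functionals to vanish, so the set is closed.
\<close>

definition periodic_ideal :: "int \<Rightarrow> 'a ell1 set"
  where "periodic_ideal n =
    {a. (\<forall>k x. zpow \<sigma> n x \<noteq> x \<longrightarrow> coef a k x = 0) \<and> (\<forall>m x. residue_sum n a m x = 0)}"

lemma periodic_idealI:
  assumes "\<And>k x. zpow \<sigma> n x \<noteq> x \<Longrightarrow> coef a k x = 0"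
    and "\<And>m x. zpow \<sigma> n x = x \<Longrightarrow> residue_sum n a m x = 0"
  shows "a \<in> periodic_ideal n"
proof -
  have "residue_sum n a m x = 0" for m x
    using assms by (cases "zpow \<sigma> n x = x") auto
  then show ?thesis
    using assms(1) by (auto simp: periodic_ideal_def)
qed

lemma ideal_periodic_ideal:
  assumes "n \<noteq> 0"
  shows "ideal_ell1 \<sigma> (periodic_ideal n)"
proof -
  have s: "(\<lambda>j. coef a (m + j * n) x) summable_on UNIV" for a m x
    by (rule abs_summable_summable[OF summable_residue[OF assms]])
  have "csubspace_ell1 (periodic_ideal n)"
    unfolding csubspace_ell1_def periodic_ideal_def
    by (auto simp: infsum_add[OF s s] infsum_cmult_right')
  moreover have "mult_ell1 \<sigma> a b \<in> periodic_ideal n" if a: "a \<in> periodic_ideal n" for a b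
  proof (rule periodic_idealI)
    show "coef (mult_ell1 \<sigma> a b) k x = 0" if "zpow \<sigma> n x \<noteq> x" for k x
      using that a by (simp add: coef_mult periodic_ideal_def)
    show "residue_sum n (mult_ell1 \<sigma> a b) m x = 0" if "zpow \<sigma> n x = x" for m x
      unfolding residue_sum_mult_left[OF assms that] using a by (simp add: periodic_ideal_def)
  qed
  moreover have "mult_ell1 \<sigma> b a \<in> periodic_ideal n" if a: "a \<in> periodic_ideal n" for a b
  proof (rule periodic_idealI)
    show "coef (mult_ell1 \<sigma> b a) k x = 0" if x: "zpow \<sigma> n x \<noteq> x" for k x
    proof -
      have "zpow \<sigma> n (zpow \<sigma> (- l) x) \<noteq> zpow \<sigma> (- l) x" for l
        using zpow_fixed_shift[OF bij_sigma, of n "zpow \<sigma> (- l) x" l] x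
        by (auto simp: zpow_minus_cancel[OF bij_sigma])
      then show ?thesis
        using a by (simp add: coef_mult periodic_ideal_def)
    qed
    show "residue_sum n (mult_ell1 \<sigma> b a) m x = 0" for m x
      unfolding residue_sum_mult_right[OF assms] using a by (simp add: periodic_ideal_def)
  qed
  ultimately show ?thesis
    by (simp add: ideal_ell1_def)
qed

lemma self_adjoint_periodic_ideal:
  "self_adjoint \<sigma> (periodic_ideal n)"
  unfolding self_adjoint_def
proof (intro ballI periodic_idealI)
  fix a :: "'a ell1" assume a: "a \<in> periodic_ideal n"
  show "coef (star_ell1 \<sigma> a) k x = 0" if "zpow \<sigma> n x \<noteq> x" for k x
  proof -
    have "zpow \<sigma> n (zpow \<sigma> (- k) x) \<noteq> zpow \<sigma> (- k) x"
      using zpow_fixed_shift[OF bij_sigma, of n "zpow \<sigma> (- k) x" k] that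
      by (auto simp: zpow_minus_cancel[OF bij_sigma])
    then show ?thesis
      using a by (simp add: coef_star periodic_ideal_def)
  qed
  show "residue_sum n (star_ell1 \<sigma> a) m x = 0" if "zpow \<sigma> n x = x" for m x
  proof -
    have "zpow \<sigma> (- (m + j * n)) x = zpow \<sigma> (- m) x" for j
      using zpow_add[OF bij_sigma, of "- m" "- j * n" x] zpow_fixed_mult[OF bij_sigma that, of "- j"]
      by simp
    then have "residue_sum n (star_ell1 \<sigma> a) m x
        = (\<Sum>\<^sub>\<infinity>j. cnj (coef a (- m + (- j) * n) (zpow \<sigma> (- m) x)))"
      by (simp add: coef_star)
    also have "\<dots> = cnj (\<Sum>\<^sub>\<infinity>j. coef a (- m + (- j) * n) (zpow \<sigma> (- m) x))"
      by (rule infsum_cnj)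
    also have "(\<Sum>\<^sub>\<infinity>j. coef a (- m + (- j) * n) (zpow \<sigma> (- m) x))
        = residue_sum n a (- m) (zpow \<sigma> (- m) x)"
      by (rule infsum_reindex_bij_witness[where i = uminus and j = uminus]) auto
    also have "\<dots> = 0"
      using a unfolding periodic_ideal_def by blast
    finally show ?thesis by simp
  qed
qed

lemma closed_periodic_ideal:
  assumes "n \<noteq> 0"
  shows "closed (periodic_ideal n)"
  unfolding periodic_ideal_def
  by (intro closed_Collect_conj closed_Collect_all closed_Collect_imp closed_Collect_eq
      open_Collect_const continuous_on_const
      linear_continuous_on[OF bounded_linear_coef]
      linear_continuous_on[OF bounded_linear_residue_sum[OF assms]])

lemma periodic_ideal_Int_CX: "n \<noteq> 0 \<Longrightarrow> periodic_ideal n \<inter> CX = {0}"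
proof -
  assume n: "n \<noteq> 0"
  have "f = 0" if "monom_ell1 f 0 \<in> periodic_ideal n" for f
  proof (rule bcontfun_eqI)
    fix x
    have "residue_sum n (monom_ell1 f 0) 0 x = apply_bcontfun f x"
      using n by (subst infsum_single[where i = 0]) (auto simp: coef_monom)
    moreover have "residue_sum n (monom_ell1 f 0) 0 x = 0"
      using that unfolding periodic_ideal_def by blast
    ultimately show "apply_bcontfun f x = apply_bcontfun 0 x"
      by simp
  qed
  moreover have "monom_ell1 0 0 = (0 :: 'a ell1)"
    by (simp add: ell1_eq_iff_coef coef_monom)
  moreover have "0 \<in> periodic_ideal n"
    by (simp add: periodic_ideal_def)
  ultimately show ?thesis
    by (auto simp: CX_eq_range)
qed

lemma topologically_free_if_self_adjoint_ideals_meet_CX: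
  assumes "\<forall>I. ideal_ell1 \<sigma> I \<and> self_adjoint \<sigma> I \<and> closed I \<and> I \<noteq> {0} \<longrightarrow> I \<inter> CX \<noteq> {0}"
  shows "topologically_free \<sigma>"
proof (rule ccontr)
  assume "\<not> topologically_free \<sigma>"
  then obtain n U x where n: "n \<noteq> 0" and U: "open U" "x \<in> U" "\<And>y. y \<in> U \<Longrightarrow> zpow \<sigma> n y = y"
    using exists_open_fixed by blast
  obtain h :: "'a \<Rightarrow>\<^sub>C complex"
    where h: "\<And>y. y \<notin> U \<Longrightarrow> apply_bcontfun h y = 0" "apply_bcontfun h x = 1"
    using bump[OF U(1,2)] by blast
  \<comment> \<open>The element \<open>h (1 - \<delta>\<^sup>n)\<close>, killed by \<open>\<delta>\<^sup>n = 1\<close>.\<close>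
  define a where "a = monom_ell1 h 0 - monom_ell1 h n"
  have "a \<in> periodic_ideal n"
  proof (rule periodic_idealI)
    show "coef a k y = 0" if "zpow \<sigma> n y \<noteq> y" for k y
      using that U(3) h(1) by (auto simp: a_def coef_monom)
    fix m y
    have s: "(\<lambda>j. coef (monom_ell1 h l) (m + j * n) y) summable_on UNIV" for l
      by (rule abs_summable_summable[OF summable_residue[OF n]])
    have "bij (\<lambda>j::int. j - 1)"
      by (rule bij_betw_byWitness[where f' = "\<lambda>j. j + 1"]) auto
    from infsum_reindex_bij_betw[OF this, of "\<lambda>j. coef (monom_ell1 h 0) (m + j * n) y"]
    have "residue_sum n (monom_ell1 h n) m y = residue_sum n (monom_ell1 h 0) m y"
      by (simp add: coef_monom algebra_simps)
    then show "residue_sum n a m y = 0"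
      by (simp add: a_def infsum_diff[OF s s])
  qed
  moreover have "a \<noteq> 0"
    using n h(2) by (auto simp: a_def ell1_eq_iff_coef coef_monom intro!: exI[of _ 0] exI[of _ x])
  ultimately show False
    using assms ideal_periodic_ideal[OF n] self_adjoint_periodic_ideal[of n]
      closed_periodic_ideal[OF n] periodic_ideal_Int_CX[OF n] by blast
qed

section \<open>Topological freeness forces ideals to meet the continuous functions\<close>

lemma scaleC_mem: "ideal_ell1 \<sigma> I \<Longrightarrow> a \<in> I \<Longrightarrow> scaleC_ell1 c a \<in> I"
  by (simp add: ideal_ell1_def csubspace_ell1_def)

lemma add_mem: "ideal_ell1 \<sigma> I \<Longrightarrow> a \<in> I \<Longrightarrow> b \<in> I \<Longrightarrow> a + b \<in> I"
  by (simp add: ideal_ell1_def csubspace_ell1_def)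

lemma mult_mem:
  "ideal_ell1 \<sigma> I \<Longrightarrow> a \<in> I \<Longrightarrow> mult_ell1 \<sigma> a b \<in> I"
  "ideal_ell1 \<sigma> I \<Longrightarrow> a \<in> I \<Longrightarrow> mult_ell1 \<sigma> b a \<in> I"
  by (simp_all add: ideal_ell1_def)

text \<open>
  Modulo \<open>I\<close>, right multiplication by \<open>p\<close> fixes \<open>b\<close>, so \<open>b\<close> is congruent to its images under all iterates
  of this contraction, which tend to \<open>0\<close>. Iterating avoids inverting \<open>1 - p\<close>.
\<close>

lemma mem_closed_ideal_if_contractive:
  assumes I: "ideal_ell1 \<sigma> I" "closed I"
    and p: "norm p < 1" "b - mult_ell1 \<sigma> b p \<in> I"
  shows "b \<in> I"
proof -
  define s where "s j = ((\<lambda>z. mult_ell1 \<sigma> z p) ^^ j) b" for j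
  have "b - s j \<in> I" for j
  proof (induction j)
    case 0
    show ?case
      using I(1) by (simp add: s_def ideal_ell1_def csubspace_ell1_def)
  next
    case (Suc j)
    have "b - s (Suc j) = (b - mult_ell1 \<sigma> b p) + mult_ell1 \<sigma> (b - s j) p"
      by (simp add: s_def mult_diff_left)
    then show ?case
      using add_mem[OF I(1) p(2) mult_mem(1)[OF I(1) Suc, of p]] by (simp only:)
  qed
  moreover have bound: "norm (s j) \<le> norm b * norm p ^ j" for j
  proof (induction j)
    case (Suc j)
    have "norm (s (Suc j)) \<le> norm (s j) * norm p"
      by (simp add: s_def norm_mult_ell1)
    also have "\<dots> \<le> norm b * norm p ^ j * norm p"
      by (rule mult_right_mono[OF Suc]) simp
    finally show ?case by (simp add: mult_ac)
  qed (simp add: s_def)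
  have "(\<lambda>j. norm b * norm p ^ j) \<longlonglongrightarrow> 0"
    using p(1) by (intro tendsto_mult_right_zero LIMSEQ_power_zero) simp
  then have "s \<longlonglongrightarrow> 0"
    by (rule Lim_null_comparison[rotated]) (simp add: bound)
  then have "(\<lambda>j. b - s j) \<longlonglongrightarrow> b - 0"
    by (intro tendsto_diff tendsto_const)
  ultimately show ?thesis
    using closed_sequentially[OF I(2), of "\<lambda>j. b - s j" b] by simp
qed

lemma open_nbhd_moved_off:
  assumes "zpow \<sigma> k x \<noteq> x"
  obtains V where "open V" "x \<in> V" "\<And>y. y \<in> V \<Longrightarrow> zpow \<sigma> k y \<notin> V"
proof -
  obtain A B where AB: "open A" "open B" "x \<in> A" "zpow \<sigma> k x \<in> B" "A \<inter> B = {}"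
    using hausdorff assms by metis
  have "open (zpow \<sigma> k -` B)"
    using AB(2) continuous_zpow by (simp add: continuous_on_open_vimage)
  then show thesis
    using AB by (intro that[of "A \<inter> zpow \<sigma> k -` B"]) auto
qed

text \<open>
  The compression argument: near an aperiodic point, \<open>f a f\<close> is close to the function \<open>f\<^sup>2 a(0)\<close>. If
  \<open>a(0)\<close> did not vanish there, a bump \<open>h\<close> would satisfy \<open>h - h p \<in> I\<close> with \<open>\<parallel>p\<parallel> < 1\<close> and would
  therefore lie in \<open>I\<close>.
\<close>

lemma coef_0_eq_0_at_aperiodic:
  assumes I: "ideal_ell1 \<sigma> I" "closed I" "I \<inter> CX = {0}"
    and "b \<in> I" and x: "\<forall>n\<ge>1. (\<sigma> ^^ n) x \<noteq> x"
  shows "coef b 0 x = 0"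
proof (rule ccontr)
  assume nz: "coef b 0 x \<noteq> 0"
  define a where "a = scaleC_ell1 (1 / coef b 0 x) b"
  have aI: "a \<in> I"
    using I(1) \<open>b \<in> I\<close> by (simp add: a_def scaleC_mem)
  have a1: "coef a 0 x = 1"
    using nz by (simp add: a_def)
  obtain F where F: "finite F" "(\<Sum>\<^sub>\<infinity>k\<in>- F. norm (apply_ell1 a k)) \<le> 1/2"
    using small_tail[of "1/2" a] by auto
  have "\<exists>V. open V \<and> x \<in> V \<and> (\<forall>y\<in>V. zpow \<sigma> (- k) y \<notin> V)" if "k \<noteq> 0" for k
  proof -
    have "zpow \<sigma> (- k) x \<noteq> x"
      using aperiodic_zpow[OF x, of "- k"] that by simp
    then show ?thesis
      by (rule open_nbhd_moved_off) blast
  qed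
  then obtain V where V: "\<And>k. k \<noteq> 0 \<Longrightarrow> open (V k)" "\<And>k. k \<noteq> 0 \<Longrightarrow> x \<in> V k"
    "\<And>k y. k \<noteq> 0 \<Longrightarrow> y \<in> V k \<Longrightarrow> zpow \<sigma> (- k) y \<notin> V k"
    by metis
  define W where "W = {y. norm (1 - coef a 0 y) < 1/4}"
  define U where "U = W \<inter> (\<Inter>k\<in>F - {0}. V k)"
  have "open W"
    unfolding W_def by (intro open_Collect_less continuous_intros) auto
  then have "open U"
    unfolding U_def using F(1) V(1) by (intro open_Int open_INT) auto
  moreover have "x \<in> U"
    using V(2) a1 by (auto simp: U_def W_def)
  ultimately obtain f h :: "'a \<Rightarrow>\<^sub>C complex" where
    f0: "\<And>y. y \<notin> U \<Longrightarrow> apply_bcontfun f y = 0" and f1: "\<And>y. norm (apply_bcontfun f y) \<le> 1"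
    and hf: "\<And>y. apply_bcontfun h y * apply_bcontfun f y = apply_bcontfun h y"
    and hx: "apply_bcontfun h x = 1"
    using bump_pair by blast
  define c where "c = mult_ell1 \<sigma> (mult_ell1 \<sigma> (monom_ell1 f 0) a) (monom_ell1 f 0)"
  have cI: "c \<in> I"
    using aI I(1) by (simp add: c_def mult_mem)
  have coef_c: "coef c n y
      = apply_bcontfun f y * coef a n y * apply_bcontfun f (zpow \<sigma> (- n) y)" for n y
    by (simp add: c_def coef_mult_monom_left coef_mult_monom_right)
  \<comment> \<open>Since \<open>h f = h\<close>, multiplying \<open>?q\<close> by \<open>h\<close> gives \<open>h\<close>, so that \<open>h - h p = h c\<close>. The coefficient of
    \<open>p\<close> at \<open>0\<close> is \<open>f (1 - a(0))\<close>, of norm at most \<open>1/4\<close>; those at the other indices in \<open>F\<close> vanish; the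
    tail contributes at most \<open>1/2\<close>.\<close>
  let ?q = "f - f * apply_ell1 a 0 + f * f * apply_ell1 a 0"
  define p where "p = monom_ell1 ?q 0 - c"
  have coef_p: "coef p n y = (if n = 0 then apply_bcontfun f y * (1 - coef a 0 y) else - coef c n y)"
    for n y
    by (simp add: p_def coef_monom coef_c times_bcontfun.rep_eq algebra_simps)
  have p_0: "norm (apply_ell1 p 0) \<le> 1/4"
  proof (rule norm_bound)
    fix y
    show "norm (coef p 0 y) \<le> 1/4"
    proof (cases "y \<in> U")
      case True
      then have "norm (1 - coef a 0 y) \<le> 1/4"
        by (simp add: U_def W_def)
      then have "norm (apply_bcontfun f y) * norm (1 - coef a 0 y) \<le> 1 * (1/4)"
        using f1 by (intro mult_mono) auto
      then show ?thesis
        by (simp add: coef_p norm_mult)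
    qed (simp add: coef_p f0)
  qed
  have p_F: "apply_ell1 p n = 0" if "n \<in> F" "n \<noteq> 0" for n
  proof (rule bcontfun_eqI)
    fix y
    have "y \<notin> U \<or> zpow \<sigma> (- n) y \<notin> U"
      using V(3)[of n y] that by (auto simp: U_def)
    then show "coef p n y = apply_bcontfun 0 y"
      using that f0 by (auto simp: coef_p coef_c)
  qed
  have p_le: "norm (apply_ell1 p n) \<le> norm (apply_ell1 a n)" if "n \<noteq> 0" for n
  proof (rule norm_bound)
    fix y
    have "norm (apply_bcontfun f y) * norm (coef a n y) * norm (apply_bcontfun f (zpow \<sigma> (- n) y))
        \<le> 1 * norm (apply_ell1 a n) * 1"
      using f1 by (intro mult_mono norm_coef_le) auto
    then show "norm (coef p n y) \<le> norm (apply_ell1 a n)"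
      using that by (simp add: coef_p coef_c norm_mult)
  qed
  have sp: "(\<lambda>k. norm (apply_ell1 p k)) summable_on S" for S
    by (rule summable_on_subset_banach[OF summable_apply_ell1]) simp
  have "norm p = (\<Sum>\<^sub>\<infinity>k\<in>insert 0 F \<union> - insert 0 F. norm (apply_ell1 p k))"
    unfolding norm_ell1.rep_eq by (simp add: Compl_partition)
  also have "\<dots> = (\<Sum>\<^sub>\<infinity>k\<in>insert 0 F. norm (apply_ell1 p k))
      + (\<Sum>\<^sub>\<infinity>k\<in>- insert 0 F. norm (apply_ell1 p k))"
    by (intro infsum_Un_disjoint sp) auto
  also have "(\<Sum>\<^sub>\<infinity>k\<in>insert 0 F. norm (apply_ell1 p k)) = norm (apply_ell1 p 0)"
    using F(1) by (simp add: sum.insert_remove p_F)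
  also have "(\<Sum>\<^sub>\<infinity>k\<in>- insert 0 F. norm (apply_ell1 p k)) \<le> (\<Sum>\<^sub>\<infinity>k\<in>- F. norm (apply_ell1 a k))"
    by (rule infsum_mono_neutral)
      (auto intro: p_le sp summable_on_subset_banach[OF summable_apply_ell1[of a]])
  finally have "norm p < 1"
    using p_0 F(2) by linarith
  moreover have "monom_ell1 h 0 - mult_ell1 \<sigma> (monom_ell1 h 0) p = mult_ell1 \<sigma> (monom_ell1 h 0) c"
    unfolding ell1_eq_iff_coef
  proof (intro allI)
    fix n y
    have "apply_bcontfun h y - apply_bcontfun h y * (apply_bcontfun f y * (1 - coef a 0 y))
        = apply_bcontfun h y - (apply_bcontfun h y * apply_bcontfun f y) * (1 - coef a 0 y)"
      by (simp only: mult.assoc)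
    also have "\<dots> = apply_bcontfun h y * coef a 0 y"
      unfolding hf by (simp add: algebra_simps)
    also have "\<dots> = (apply_bcontfun h y * apply_bcontfun f y) * apply_bcontfun f y * coef a 0 y"
      by (simp only: hf)
    finally have "apply_bcontfun h y - apply_bcontfun h y * (apply_bcontfun f y * (1 - coef a 0 y))
        = apply_bcontfun h y * coef c 0 y"
      by (simp add: coef_c mult_ac)
    then show "coef (monom_ell1 h 0 - mult_ell1 \<sigma> (monom_ell1 h 0) p) n y
        = coef (mult_ell1 \<sigma> (monom_ell1 h 0) c) n y"
      by (simp add: coef_mult_monom_left coef_monom coef_p)
  qed
  then have "monom_ell1 h 0 - mult_ell1 \<sigma> (monom_ell1 h 0) p \<in> I"
    using cI I(1) by (simp add: mult_mem)
  ultimately have "monom_ell1 h 0 \<in> I"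
    by (rule mem_closed_ideal_if_contractive[OF I(1,2)])
  then have "monom_ell1 h 0 = 0"
    using I(3) monom_0_in_CX[of h] by auto
  then have "coef (monom_ell1 h 0) 0 x = 0"
    by simp
  then show False
    using hx by (simp add: coef_monom)
qed

text \<open>
  Multiplying by \<open>\<delta>\<^sup>-\<^sup>n\<close> moves the coefficient at \<open>n\<close> to \<open>0\<close> without leaving the ideal.
\<close>

lemma ideals_meet_CX_if_topologically_free:
  assumes "topologically_free \<sigma>" and I: "ideal_ell1 \<sigma> I" "closed I" "I \<inter> CX = {0}"
  shows "I = {0}"
proof -
  have "a = 0" if "a \<in> I" for a
  proof (rule ell1_eqI)
    fix n
    let ?b = "mult_ell1 \<sigma> a (monom_ell1 (const_bcontfun 1) (- n))"
    have "apply_ell1 a n = 0"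
    proof (rule zero_if_zero_on_aperiodic[OF assms(1)])
      fix x assume "\<forall>n\<ge>1. (\<sigma> ^^ n) x \<noteq> x"
      then have "coef ?b 0 x = 0"
        using coef_0_eq_0_at_aperiodic[OF I] mult_mem(1)[OF I(1) that] by blast
      then show "coef a n x = 0"
        by (simp add: coef_mult_monom_right const_bcontfun.rep_eq)
    qed
    then show "apply_ell1 a n = apply_ell1 0 n"
      by (simp add: zero_ell1.rep_eq)
  qed
  then show ?thesis
    using I(1) by (auto simp: ideal_ell1_def csubspace_ell1_def)
qed

end

theorem theorem4p1:
  fixes \<sigma> :: "'a::t2_space \<Rightarrow> 'a"
  assumes "compact (UNIV :: 'a set)"
    and "homeomorphism UNIV UNIV \<sigma> (inv \<sigma>)"
  shows "((\<forall>I. ideal_ell1 \<sigma> I \<and> closed I \<and> I \<noteq> {0} \<longrightarrow> I \<inter> CX \<noteq> {0})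
        \<longleftrightarrow> (\<forall>I. ideal_ell1 \<sigma> I \<and> self_adjoint \<sigma> I \<and> closed I \<and> I \<noteq> {0} \<longrightarrow> I \<inter> CX \<noteq> {0}))
    \<and> ((\<forall>I. ideal_ell1 \<sigma> I \<and> self_adjoint \<sigma> I \<and> closed I \<and> I \<noteq> {0} \<longrightarrow> I \<inter> CX \<noteq> {0})
        \<longleftrightarrow> maximal_abelian_subalgebra \<sigma> CX)
    \<and> (maximal_abelian_subalgebra \<sigma> CX \<longleftrightarrow> topologically_free \<sigma>)"
    (is "(?all \<longleftrightarrow> ?self_adjoint) \<and> (?self_adjoint \<longleftrightarrow> ?maximal) \<and> (?maximal \<longleftrightarrow> ?free)")
proof -
  interpret compact_system \<sigma>
    by unfold_locales (rule assms)+
  have "?free \<Longrightarrow> ?all"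
    using ideals_meet_CX_if_topologically_free by blast
  moreover have "?all \<Longrightarrow> ?self_adjoint"
    by blast
  moreover have "?self_adjoint \<Longrightarrow> ?free"
    by (rule topologically_free_if_self_adjoint_ideals_meet_CX)
  moreover have "?maximal \<longleftrightarrow> ?free"
    using topologically_free_if_maximal maximal_if_topologically_free by blast
  ultimately show ?thesis
    by argo
qed

end
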